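(* For every integer $n>2$, the algebra $\mathfrak{E}^{\{2\}}_{n+1}$ is not qualitatively representable.
   Context: Let $C=\{c_1,\dots,c_n\}$ and $C^+=\{1'\}\cup C$. The chromatic algebra $\mathfrak{E}^{\{2\}}_{n+1}$: a triple $(x,y,z)\in (C^+)^3$ is consistent if either one of $x,y,z$ equals $1'$ and the other two are equal, or $x,y,z\in C$ and $|\{x,y,z\}|=2$. The algebra has universe the power set of $C^+$, set-theoretic Boolean operations ($0=\varnothing$, $1=C^+$), identity $\{1'\}$, converse the identity map, and composition $X;Y=\{z:(x,y,z)\text{ consistent for some }x\in X,y\in Y\}$; $\leq$ is inclusion. A qualitative representation of $\mathbf A$ on a set $U$ is an injective Boolean algebra homomorphism $\varphi$ from $\mathbf A$ into the power set of $U\times U$ with $\varphi(0)=\varnothing$, $\varphi(1)=U\times U$, $\varphi(1')=\mathrm{Id}_U$, $\varphi(\breve x)=\varphi(x)^{\smile}$, and $\varphi(x)\circ\varphi(y)\subseteq\varphi(z)$ iff $x;y\leq z$ for all $x,y,z$ ($\circ$ relational composition). The algebra is qualitatively representable if it has a qualitative representation on some set. *)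

theory Defs
  imports Main
begin

record 'a relation_type_algebra =
  alg_carrier :: "'a set"
  alg_join :: "'a \<Rightarrow> 'a \<Rightarrow> 'a"
  alg_meet :: "'a \<Rightarrow> 'a \<Rightarrow> 'a"
  alg_compl :: "'a \<Rightarrow> 'a"
  alg_zero :: "'a"
  alg_one :: "'a"
  alg_ident :: "'a"
  alg_conv :: "'a \<Rightarrow> 'a"
  alg_comp :: "'a \<Rightarrow> 'a \<Rightarrow> 'a"
  alg_le :: "'a \<Rightarrow> 'a \<Rightarrow> bool"

definition qualitative_representation ::
  "('a, 'm) relation_type_algebra_scheme \<Rightarrow> 'u set \<Rightarrow> ('a \<Rightarrow> ('u \<times> 'u) set) \<Rightarrow> bool" where
  "qualitative_representation A U \<phi> \<longleftrightarrow>
     \<phi> ` alg_carrier A \<subseteq> Pow (U \<times> U) \<and>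
     inj_on \<phi> (alg_carrier A) \<and>
     (\<forall>x\<in>alg_carrier A. \<forall>y\<in>alg_carrier A. \<phi> (alg_join A x y) = \<phi> x \<union> \<phi> y) \<and>
     (\<forall>x\<in>alg_carrier A. \<forall>y\<in>alg_carrier A. \<phi> (alg_meet A x y) = \<phi> x \<inter> \<phi> y) \<and>
     (\<forall>x\<in>alg_carrier A. \<phi> (alg_compl A x) = U \<times> U - \<phi> x) \<and>
     \<phi> (alg_zero A) = {} \<and>
     \<phi> (alg_one A) = U \<times> U \<and>
     \<phi> (alg_ident A) = Id_on U \<and>
     (\<forall>x\<in>alg_carrier A. \<phi> (alg_conv A x) = (\<phi> x)\<inverse>) \<and>
     (\<forall>x\<in>alg_carrier A. \<forall>y\<in>alg_carrier A. \<forall>z\<in>alg_carrier A.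
        \<phi> x O \<phi> y \<subseteq> \<phi> z \<longleftrightarrow> alg_le A (alg_comp A x y) z)"

text \<open>
  HOL cannot quantify over types inside a formula, so the type of the points of the base set
  is a parameter. Non-representability on arbitrary sets is the negation of this predicate
  with the type argument left polymorphic.
\<close>

definition qualitatively_representable ::
  "'u itself \<Rightarrow> ('a, 'm) relation_type_algebra_scheme \<Rightarrow> bool" where
  "qualitatively_representable _ A \<longleftrightarrow>
     (\<exists>(U :: 'u set) \<phi>. qualitative_representation A U \<phi>)"

datatype chromatic_atom = Ident | Colour nat

definition colours :: "nat \<Rightarrow> chromatic_atom set" where
  "colours n = Colour ` {1..n}"

definition chromatic_atoms :: "nat \<Rightarrow> chromatic_atom set" where
  "chromatic_atoms n = {Ident} \<union> colours n"

definition consistent ::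
  "nat \<Rightarrow> chromatic_atom \<Rightarrow> chromatic_atom \<Rightarrow> chromatic_atom \<Rightarrow> bool" where
  "consistent n x y z \<longleftrightarrow>
     {x, y, z} \<subseteq> chromatic_atoms n \<and>
     (x = Ident \<and> y = z \<or> y = Ident \<and> x = z \<or> z = Ident \<and> x = y \<or>
      {x, y, z} \<subseteq> colours n \<and> card {x, y, z} = 2)"

text \<open>
  The argument is the number of colours, so \<open>chromatic_algebra_2 n\<close> is
  \<open>\<EE>\<^sup>{\<^sup>2\<^sup>}\<^bsub>n+1\<^esub>\<close>, which has \<open>n + 1\<close> atoms.
\<close>

definition chromatic_algebra_2 :: "nat \<Rightarrow> chromatic_atom set relation_type_algebra" where
  "chromatic_algebra_2 n =
     \<lparr> alg_carrier = Pow (chromatic_atoms n),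
       alg_join = (\<lambda>X Y. X \<union> Y),
       alg_meet = (\<lambda>X Y. X \<inter> Y),
       alg_compl = (\<lambda>X. chromatic_atoms n - X),
       alg_zero = {},
       alg_one = chromatic_atoms n,
       alg_ident = {Ident},
       alg_conv = (\<lambda>X. X),
       alg_comp = (\<lambda>X Y. {z. \<exists>x\<in>X. \<exists>y\<in>Y. consistent n x y z}),
       alg_le = (\<lambda>X Y. X \<subseteq> Y) \<rparr>"

end

theory Submission
  imports Defs
begin

text \<open>
  A qualitative representation is an edge colouring of a complete graph in which every triangle
  has exactly two colours and every two-coloured pattern \<open>c, c, d\<close> occurs. By Gallai's theorem, a
  finite complete graph without rainbow triangles has two colours \<open>r\<close>, \<open>b\<close> such that the edges of
  the remaining colours do not connect it; any two components of these remaining edges are joined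
  by a single one of the colours \<open>r\<close>, \<open>b\<close>. Choose a third colour \<open>g\<close> and apply this to a finite set
  containing triangles \<open>g, g, r\<close> and \<open>g, g, b\<close>. The component of the first contains an \<open>r\<close>-edge, so,
  as monochromatic triangles are forbidden, it is joined to everything else by \<open>b\<close>; likewise the
  component of the second is joined to everything else by \<open>r\<close>. This is contradictory both if
  the two components agree and if they differ.
\<close>

section \<open>Components of the edges that avoid two colours\<close>

definition avoiding :: "('u \<Rightarrow> 'u \<Rightarrow> 'c) \<Rightarrow> 'u set \<Rightarrow> 'c \<Rightarrow> 'c \<Rightarrow> ('u \<times> 'u) set" where
  "avoiding col V r b = {(x, y). x \<in> V \<and> y \<in> V \<and> x \<noteq> y \<and> col x y \<notin> {r, b}}"

definition rainbow_free :: "('u \<Rightarrow> 'u \<Rightarrow> 'c) \<Rightarrow> 'u set \<Rightarrow> bool" where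
  "rainbow_free col V \<longleftrightarrow>
     (\<forall>x\<in>V. \<forall>y\<in>V. col x y = col y x) \<and>
     (\<forall>x\<in>V. \<forall>y\<in>V. \<forall>z\<in>V. x \<noteq> y \<longrightarrow> y \<noteq> z \<longrightarrow> x \<noteq> z \<longrightarrow>
        col x y = col y z \<or> col x y = col x z \<or> col y z = col x z)"

lemma rainbow_free_sym:
  "rainbow_free col V \<Longrightarrow> x \<in> V \<Longrightarrow> y \<in> V \<Longrightarrow> col x y = col y x"
  unfolding rainbow_free_def by blast

lemma rainbow_freeD:
  assumes "rainbow_free col V" "x \<in> V" "y \<in> V" "z \<in> V" "x \<noteq> y" "y \<noteq> z" "x \<noteq> z"
  shows "col x y = col y z \<or> col x y = col x z \<or> col y z = col x z"
  using assms unfolding rainbow_free_def by blast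

lemma rainbow_free_subset: "rainbow_free col V \<Longrightarrow> W \<subseteq> V \<Longrightarrow> rainbow_free col W"
  unfolding rainbow_free_def by (meson subsetD)

lemma sym_rtrancl_avoiding:
  assumes "rainbow_free col V"
  shows "sym ((avoiding col V r b)\<^sup>*)"
proof (rule sym_rtrancl, rule symI)
  fix x y assume "(x, y) \<in> avoiding col V r b"
  then show "(y, x) \<in> avoiding col V r b"
    using rainbow_free_sym[OF assms, of x y] by (auto simp: avoiding_def)
qed

lemma rtrancl_avoiding_in:
  "(x, y) \<in> (avoiding col V r b)\<^sup>* \<Longrightarrow> x \<in> V \<Longrightarrow> y \<in> V"
  by (induction rule: rtrancl_induct) (auto simp: avoiding_def)

lemma col_between_components:
  assumes "x \<in> V" "y \<in> V" "(x, y) \<notin> (avoiding col V r b)\<^sup>*"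
  shows "x \<noteq> y" "col x y \<in> {r, b}"
proof -
  show "x \<noteq> y" using assms by auto
  then show "col x y \<in> {r, b}"
    using assms r_into_rtrancl[of "(x, y)" "avoiding col V r b"] unfolding avoiding_def by blast
qed

text \<open>Each edge \<open>w w'\<close> of a path from \<open>x\<close> to \<open>x'\<close> has a
  colour outside \<open>{r, b}\<close>, while both edges to \<open>y\<close> have colours inside it.
  As the triangle is not rainbow, the latter two agree.\<close>

lemma component_homogeneous:
  assumes rf: "rainbow_free col V"
    and "(x, x') \<in> (avoiding col V r b)\<^sup>*" "x \<in> V" "y \<in> V" "(x, y) \<notin> (avoiding col V r b)\<^sup>*"
  shows "col x y = col x' y"
  using assms(2)
proof (induction rule: rtrancl_induct)
  case (step w w')
  have w': "(x, w') \<in> (avoiding col V r b)\<^sup>*" using step by simp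
  have n: "(w, y) \<notin> (avoiding col V r b)\<^sup>*" "(w', y) \<notin> (avoiding col V r b)\<^sup>*"
    using step(1) w' assms(5) by (meson rtrancl_trans)+
  have ww': "w \<in> V" "w' \<in> V" "w \<noteq> w'" "col w w' \<notin> {r, b}"
    using step(2) by (auto simp: avoiding_def)
  have "col w y = col w' y"
    using rainbow_freeD[OF rf ww'(1,2) \<open>y \<in> V\<close> ww'(3)]
      col_between_components[OF ww'(1) \<open>y \<in> V\<close> n(1)]
      col_between_components[OF ww'(2) \<open>y \<in> V\<close> n(2)] ww'(4) by metis
  then show ?case using step.IH by simp
qed simp

section \<open>Gallai's theorem on two-coloured cuts\<close>

definition two_colour_cut :: "('u \<Rightarrow> 'u \<Rightarrow> 'c) \<Rightarrow> 'u set \<Rightarrow> 'c \<Rightarrow> 'c \<Rightarrow> bool" where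
  "two_colour_cut col V r b \<longleftrightarrow>
     (\<exists>A. A \<noteq> {} \<and> A \<subset> V \<and> (\<forall>x\<in>A. \<forall>y\<in>V - A. col x y \<in> {r, b}))"

text \<open>No avoiding edge leaves the side \<open>A\<close> of the cut, so a point of
  \<open>A\<close> and one outside it lie in different components, and \<open>x\<close> cannot be
  connected to both.\<close>

lemma two_colour_cut_not_connected:
  assumes rf: "rainbow_free col V" and "two_colour_cut col V r b" "x \<in> V"
  obtains y where "y \<in> V" "(x, y) \<notin> (avoiding col V r b)\<^sup>*"
proof -
  obtain A where A: "A \<noteq> {}" "A \<subset> V" "\<forall>x\<in>A. \<forall>y\<in>V - A. col x y \<in> {r, b}"
    using assms(2) unfolding two_colour_cut_def by blast
  have closed: "z \<in> A" if "(y, z) \<in> (avoiding col V r b)\<^sup>*" "y \<in> A" for y z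
    using that by (induction rule: rtrancl_induct) (use A in \<open>auto simp: avoiding_def\<close>)
  obtain p q where pq: "p \<in> A" "q \<in> V - A" using A by blast
  have "(p, q) \<notin> (avoiding col V r b)\<^sup>*" using closed pq by blast
  then have "(x, p) \<notin> (avoiding col V r b)\<^sup>* \<or> (x, q) \<notin> (avoiding col V r b)\<^sup>*"
    by (meson rtrancl_trans sym_rtrancl_avoiding[OF rf] symE)
  then show thesis using that pq A by blast
qed

text \<open>Induction step of Gallai's theorem. If \<open>v\<close> sends only \<open>r\<close> and
  \<open>b\<close> to some component of \<open>V\<close>, that component is one side of a cut.
  Otherwise \<open>{v}\<close> is, with one of the two colours replaced by a colour occurring at
  \<open>v\<close>.\<close>

lemma two_colour_cut_insert:
  assumes rf: "rainbow_free col (insert v V)" and v: "v \<notin> V" and "V \<noteq> {}"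
    and cut: "two_colour_cut col V r b"
  shows "two_colour_cut col (insert v V) r b \<or>
    (\<exists>x\<in>V. two_colour_cut col (insert v V) (col v x) r \<or>
            two_colour_cut col (insert v V) (col v x) b)"
proof -
  let ?E = "(avoiding col V r b)\<^sup>*"
  have rfV: "rainbow_free col V" using rf by (rule rainbow_free_subset) blast
  have E_sym: "(y, x) \<in> ?E" if "(x, y) \<in> ?E" for x y
    using that sym_rtrancl_avoiding[OF rfV] by (meson symE)
  note hom = component_homogeneous[OF rfV]
  have csym: "col x y = col y x" if "x \<in> V" "y \<in> V" for x y
    using that by (rule rainbow_free_sym[OF rfV])
  have tri: "col v x = col v y \<or> col x y = col v x \<or> col x y = col v y"
    if "x \<in> V" "y \<in> V" "x \<noteq> y" for x y
    using rainbow_freeD[OF rf, of v x y] that v by (metis insertCI)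
  show ?thesis
  proof (cases "\<exists>x\<in>V. \<forall>x'. (x, x') \<in> ?E \<longrightarrow> col v x' \<in> {r, b}")
    case True
    then obtain x where x: "x \<in> V" "\<And>x'. (x, x') \<in> ?E \<Longrightarrow> col v x' \<in> {r, b}" by blast
    let ?A = "?E `` {x}"
    have sub: "?A \<subseteq> V" using x(1) rtrancl_avoiding_in by fastforce
    have "col p q \<in> {r, b}" if "p \<in> ?A" "q \<in> insert v V - ?A" for p q
    proof (cases "q = v")
      case True
      have "col p v = col v p" using rainbow_free_sym[OF rf] that(1) sub by blast
      then show ?thesis using x(2)[of p] that(1) True by simp
    next
      case False
      have "p \<in> V" "q \<in> V" "(p, q) \<notin> ?E" using that sub False by (auto dest: rtrancl_trans)
      then show ?thesis by (rule col_between_components(2))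
    qed
    moreover have "?A \<noteq> {}" "?A \<subset> insert v V" using sub v by auto
    ultimately have "two_colour_cut col (insert v V) r b"
      unfolding two_colour_cut_def by (intro exI[of _ ?A] conjI ballI)
    then show ?thesis ..
  next
    case False
    then have reach: "\<exists>x'\<in>V. (x, x') \<in> ?E \<and> col v x' \<notin> {r, b}" if "x \<in> V" for x
      using that rtrancl_avoiding_in by metis
    \<comment> \<open>Now \<open>v\<close> has an edge outside \<open>r\<close>, \<open>b\<close> to every component. All these edges share a single
      colour \<open>g\<close>, and the other edges at \<open>v\<close> share a single colour, so \<open>{v}\<close> is the new cut.\<close>
    obtain x0 where x0: "x0 \<in> V" "col v x0 \<notin> {r, b}" using reach \<open>V \<noteq> {}\<close> by blast
    define g where "g = col v x0"
    have far: "\<exists>z\<in>V. (x, z) \<notin> ?E \<and> col v z \<notin> {r, b}" if x: "x \<in> V" for x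
    proof -
      obtain y where y: "y \<in> V" "(x, y) \<notin> ?E"
        using two_colour_cut_not_connected[OF rfV cut x] .
      obtain z where z: "z \<in> V" "(y, z) \<in> ?E" "col v z \<notin> {r, b}" using reach[OF y(1)] by blast
      have "(x, z) \<notin> ?E" using y(2) E_sym[OF z(2)] by (meson rtrancl_trans)
      then show ?thesis using z by blast
    qed
    \<comment> \<open>The edge between the two components is coloured \<open>r\<close> or
      \<open>b\<close>, hence unlike both edges at \<open>v\<close>, which must then agree.\<close>
    have eq_far: "col v x = col v y"
      if "x \<in> V" "y \<in> V" "(x, y) \<notin> ?E" "col v x \<notin> {r, b}" "col v y \<notin> {r, b}" for x y
      using tri[OF that(1,2)] col_between_components[OF that(1-3)] that(4,5) by metis
    have only_g: "col v y = g" if y: "y \<in> V" "col v y \<notin> {r, b}" for y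
    proof (cases "(x0, y) \<in> ?E")
      case True
      \<comment> \<open>\<open>eq_far\<close> needs different components, so both points are
        compared with a \<open>z\<close> in another one.\<close>
      obtain z where z: "z \<in> V" "(x0, z) \<notin> ?E" "col v z \<notin> {r, b}" using far x0(1) by blast
      have "(y, z) \<notin> ?E" using True z(2) by (meson rtrancl_trans)
      then show ?thesis using eq_far[OF x0(1) z(1,2) x0(2) z(3)] eq_far[OF y(1) z(1) _ y(2) z(3)]
        by (simp add: g_def)
    next
      case False
      then show ?thesis using eq_far[OF x0(1) y(1) _ x0(2) y(2)] by (simp add: g_def)
    qed
    \<comment> \<open>Here \<open>v z\<close> is the odd edge of the triangle, which forces the
      other two to agree.\<close>
    have spread: "col x z = col v x"
      if "x \<in> V" "z \<in> V" "(x, z) \<notin> ?E" "col v x \<in> {r, b}" "col v z \<notin> {r, b}" for x z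
      using tri[OF that(1,2)] col_between_components[OF that(1-3)] that(4,5) by metis
    have one: "col v x = col v y" if xy: "x \<in> V" "y \<in> V" "col v x \<in> {r, b}" "col v y \<in> {r, b}"
      for x y
    proof (cases "(x, y) \<in> ?E")
      case True
      obtain z where z: "z \<in> V" "(x, z) \<notin> ?E" "col v z \<notin> {r, b}" using far xy(1) by blast
      have yz: "(y, z) \<notin> ?E" using True z(2) by (meson rtrancl_trans)
      show ?thesis
        using spread[OF xy(1) z(1,2) xy(3) z(3)] spread[OF xy(2) z(1) yz xy(4) z(3)]
          hom[OF True xy(1) z(1,2)] by simp
    next
      case False
      \<comment> \<open>The edge \<open>x y\<close> mediates: \<open>spread\<close> moves the
        colours of \<open>v x\<close> and \<open>v y\<close> to \<open>x y'\<close> and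
        \<open>y x'\<close>, and homogeneity identifies both with the colour of
        \<open>x y\<close>.\<close>
      obtain x' where x': "x' \<in> V" "(x, x') \<in> ?E" "col v x' \<notin> {r, b}" using reach xy(1) by blast
      obtain y' where y': "y' \<in> V" "(y, y') \<in> ?E" "col v y' \<notin> {r, b}" using reach xy(2) by blast
      have n: "(x, y') \<notin> ?E" "(y, x') \<notin> ?E" "(y, x) \<notin> ?E"
        using False x'(2) y'(2) by (meson E_sym rtrancl_trans)+
      have "col v x = col x y'" using spread[OF xy(1) y'(1) n(1) xy(3) y'(3)] by simp
      also have "\<dots> = col y x" using hom[OF y'(2) xy(2,1) n(3)] csym xy y'(1) by metis
      also have "\<dots> = col y x'" using hom[OF x'(2) xy(1,2) False] csym xy x'(1) by metis
      also have "\<dots> = col v y" using spread[OF xy(2) x'(1) n(2) xy(4) x'(3)] by simp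
      finally show ?thesis .
    qed
    have "(\<forall>x\<in>V. col v x \<in> {g, r}) \<or> (\<forall>x\<in>V. col v x \<in> {g, b})"
      using only_g one by (metis insert_iff singletonD)
    moreover have "{v} \<noteq> {}" "{v} \<subset> insert v V" using v \<open>V \<noteq> {}\<close> by auto
    ultimately have "two_colour_cut col (insert v V) g r \<or> two_colour_cut col (insert v V) g b"
      unfolding two_colour_cut_def by (elim disjE) (rule disjI1 disjI2, rule exI[of _ "{v}"], auto)+
    then show ?thesis using x0(1) unfolding g_def by blast
  qed
qed

text \<open>Splitting off \<open>v\<close> from a nonempty \<open>V\<close> encodes having at least
  two vertices. The palette \<open>C\<close> keeps the cut colours among those for which witness
  triangles will be available.\<close>

theorem Gallai_two_colour_cut:
  assumes "finite V" "V \<noteq> {}" "rainbow_free col (insert v V)" "v \<notin> V"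
    and "\<And>x y. x \<in> insert v V \<Longrightarrow> y \<in> insert v V \<Longrightarrow> x \<noteq> y \<Longrightarrow> col x y \<in> C"
  shows "\<exists>r\<in>C. \<exists>b\<in>C. two_colour_cut col (insert v V) r b"
  using assms
proof (induction V arbitrary: v rule: finite_ne_induct)
  case (singleton w)
  \<comment> \<open>A single edge is a cut with both colours equal, which the definition
    allows.\<close>
  then have "two_colour_cut col {v, w} (col v w) (col v w)"
    unfolding two_colour_cut_def by (intro exI[of _ "{v}"]) auto
  then show ?case using singleton.prems by auto
next
  case (insert w V)
  have "rainbow_free col (insert w V)" using insert.prems(1) by (rule rainbow_free_subset) blast
  then obtain r b where rb: "r \<in> C" "b \<in> C" "two_colour_cut col (insert w V) r b"
    using insert.IH[of w] insert.hyps insert.prems(3) by blast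
  have "col v x \<in> C" if "x \<in> insert w V" for x
    using insert.prems(2,3) that by blast
  then show ?case
    using two_colour_cut_insert[OF insert.prems(1,2) _ rb(3)] rb(1,2) by blast
qed

section \<open>Contradiction from the witness triangles\<close>

lemma two_coloured_triangles_contradiction:
  assumes C: "card C > 2"
    and csym: "\<And>x y. x \<in> U \<Longrightarrow> y \<in> U \<Longrightarrow> col x y = col y x"
    and colC: "\<And>x y. x \<in> U \<Longrightarrow> y \<in> U \<Longrightarrow> x \<noteq> y \<Longrightarrow> col x y \<in> C"
    and tri: "\<And>x y z. x \<in> U \<Longrightarrow> y \<in> U \<Longrightarrow> z \<in> U \<Longrightarrow> x \<noteq> y \<Longrightarrow> y \<noteq> z \<Longrightarrow> x \<noteq> z \<Longrightarrow>
      card {col x y, col y z, col x z} = 2"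
    and wit: "\<And>c d. c \<in> C \<Longrightarrow> d \<in> C \<Longrightarrow> c \<noteq> d \<Longrightarrow>
      \<exists>x\<in>U. \<exists>y\<in>U. \<exists>z\<in>U. x \<noteq> y \<and> y \<noteq> z \<and> x \<noteq> z \<and>
        col x y = c \<and> col y z = c \<and> col x z = d"
  shows False
proof -
  have finC: "finite C" using C card.infinite by fastforce
  \<comment> \<open>The colours \<open>r\<close> and \<open>b\<close> are known only after the
    finite vertex set is fixed, so one witness triangle is chosen in advance for every ordered pair
    of distinct colours.\<close>
  define W where "W c d = (SOME (x, y, z). x \<in> U \<and> y \<in> U \<and> z \<in> U \<and> x \<noteq> y \<and> y \<noteq> z \<and> x \<noteq> z \<and>
        col x y = c \<and> col y z = c \<and> col x z = d)" for c d
  define p q s where "p = (\<lambda>c d. fst (W c d))" "q = (\<lambda>c d. fst (snd (W c d)))"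
    "s = (\<lambda>c d. snd (snd (W c d)))"
  have W: "p c d \<in> U \<and> q c d \<in> U \<and> s c d \<in> U \<and> p c d \<noteq> q c d \<and> q c d \<noteq> s c d \<and> p c d \<noteq> s c d \<and>
      col (p c d) (q c d) = c \<and> col (q c d) (s c d) = c \<and> col (p c d) (s c d) = d"
    if "c \<in> C" "d \<in> C" "c \<noteq> d" for c d
  proof -
    have "\<exists>w. case w of (x, y, z) \<Rightarrow> x \<in> U \<and> y \<in> U \<and> z \<in> U \<and> x \<noteq> y \<and> y \<noteq> z \<and> x \<noteq> z \<and>
        col x y = c \<and> col y z = c \<and> col x z = d" using wit[OF that] by auto
    from someI_ex[OF this] show ?thesis
      unfolding W_def[symmetric] p_q_s_def by (auto split: prod.splits)
  qed
  define V where "V = (\<Union>(c, d)\<in>{(c, d). c \<in> C \<and> d \<in> C \<and> c \<noteq> d}. {p c d, q c d, s c d})"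
  have "finite {(c, d). c \<in> C \<and> d \<in> C \<and> c \<noteq> d}"
    by (rule finite_subset[of _ "C \<times> C"]) (use finC in auto)
  then have finV: "finite V" unfolding V_def by auto
  have VU: "V \<subseteq> U" using W unfolding V_def by blast
  have inV: "p c d \<in> V" "q c d \<in> V" "s c d \<in> V" if "c \<in> C" "d \<in> C" "c \<noteq> d" for c d
    using that unfolding V_def by blast+
  have "rainbow_free col U"
    unfolding rainbow_free_def
  proof (intro conjI ballI impI)
    fix x y z assume "x \<in> U" "y \<in> U" "z \<in> U" "x \<noteq> y" "y \<noteq> z" "x \<noteq> z"
    from tri[OF this] show "col x y = col y z \<or> col x y = col x z \<or> col y z = col x z"
      by (auto simp: card_insert_if split: if_splits)
  qed (use csym in blast)
  then have rf: "rainbow_free col V" using VU by (rule rainbow_free_subset)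
  have third: "\<exists>g\<in>C. g \<noteq> r \<and> g \<noteq> b" for r b
  proof (rule ccontr)
    assume "\<not> ?thesis"
    then have "C \<subseteq> {r, b}" by blast
    then have "card C \<le> card {r, b}" by (intro card_mono) auto
    also have "\<dots> \<le> 2" by (simp add: card_insert_if)
    finally show False using C by simp
  qed
  obtain c where c: "c \<in> C" using C by (cases "C = {}") auto
  obtain d where d: "d \<in> C" "d \<noteq> c" using third[of c c] by blast
  define v where "v = p c d"
  note cd = c d(1) d(2)[symmetric]
  have "v \<in> V" "q c d \<in> V - {v}" using inV[OF cd] W[OF cd] unfolding v_def by auto
  then have V: "insert v (V - {v}) = V" "V - {v} \<noteq> {}" by auto
  obtain r b where rb: "r \<in> C" "b \<in> C" "two_colour_cut col V r b"
    using Gallai_two_colour_cut[of "V - {v}" col v C, unfolded V(1)] V(2) finV rf VU colC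
    by blast
  obtain g where g: "g \<in> C" "g \<noteq> r" "g \<noteq> b" using third by blast
  let ?E = "(avoiding col V r b)\<^sup>*"
  \<comment> \<open>The two \<open>g\<close>-edges put the whole witness triangle into one
    component. A \<open>y\<close> outside sees the ends of its \<open>a\<close>-edge in the same
    colour, which is not \<open>a\<close>, as that would give a monochromatic triangle. For
    \<open>r = b\<close> the set is empty.\<close>
  have far: "col (p g a) y \<in> {r, b} - {a}"
    if a: "a \<in> {r, b}" and y: "y \<in> V" "(p g a, y) \<notin> ?E" for a y
  proof -
    have ga: "g \<in> C" "a \<in> C" "g \<noteq> a" using a g rb by auto
    note W = W[OF ga] and inV = inV[OF ga]
    have E: "(p g a, q g a) \<in> ?E" "(p g a, s g a) \<in> ?E"
    proof -
      have "(p g a, q g a) \<in> avoiding col V r b" "(q g a, s g a) \<in> avoiding col V r b"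
        using W inV g unfolding avoiding_def by auto
      then show "(p g a, q g a) \<in> ?E" "(p g a, s g a) \<in> ?E" by auto
    qed
    have eq: "col (p g a) y = col (s g a) y"
      using component_homogeneous[OF rf E(2) inV(1) y] .
    have ne: "p g a \<noteq> y" "s g a \<noteq> y" using y E by auto
    have "card {col (p g a) (s g a), col (s g a) y, col (p g a) y} = 2"
      using W VU y(1) ne by (intro tri) auto
    then have "col (p g a) y \<noteq> a" using W eq by auto
    then show ?thesis using col_between_components(2)[OF inV(1) y] by blast
  qed
  have pV: "p g r \<in> V" "p g b \<in> V" using inV g rb by auto
  have E_sym: "(y, x) \<in> ?E" if "(x, y) \<in> ?E" for x y
    using that sym_rtrancl_avoiding[OF rf] by (meson symE)
  show False
  proof (cases "(p g r, p g b) \<in> ?E")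
    case True
    \<comment> \<open>Homogeneity makes \<open>y\<close> see both triangles in one colour, but
      \<open>far\<close> excludes \<open>r\<close> for one and \<open>b\<close> for the
      other.\<close>
    obtain y where y: "y \<in> V" "(p g r, y) \<notin> ?E"
      using two_colour_cut_not_connected[OF rf rb(3) pV(1)] by blast
    have "(p g b, y) \<notin> ?E" using True y(2) by (meson rtrancl_trans)
    then show False
      using far[of r y] far[of b y] y component_homogeneous[OF rf True pV(1) y] by auto
  next
    case False
    \<comment> \<open>Now \<open>far\<close> applies to the edge joining the triangles from both of
      its ends.\<close>
    moreover have "(p g b, p g r) \<notin> ?E" using False E_sym by blast
    ultimately show False
      using far[of r "p g b"] far[of b "p g r"] pV rainbow_free_sym[OF rf pV] by auto
  qed
qed

section \<open>From a qualitative representation to an edge colouring\<close>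

theorem theorem25:
  fixes n :: nat
  assumes "n > 2"
  shows "\<not> qualitatively_representable TYPE('u) (chromatic_algebra_2 n)"
proof
  assume "qualitatively_representable TYPE('u) (chromatic_algebra_2 n)"
  then obtain U :: "'u set" and \<phi> where "qualitative_representation (chromatic_algebra_2 n) U \<phi>"
    unfolding qualitatively_representable_def by blast
  then have
    image: "\<phi> ` Pow (chromatic_atoms n) \<subseteq> Pow (U \<times> U)" and
    joins: "\<forall>X\<in>Pow (chromatic_atoms n). \<forall>Y\<in>Pow (chromatic_atoms n). \<phi> (X \<union> Y) = \<phi> X \<union> \<phi> Y" and
    meets: "\<forall>X\<in>Pow (chromatic_atoms n). \<forall>Y\<in>Pow (chromatic_atoms n). \<phi> (X \<inter> Y) = \<phi> X \<inter> \<phi> Y" and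
    compls: "\<forall>X\<in>Pow (chromatic_atoms n). \<phi> (chromatic_atoms n - X) = U \<times> U - \<phi> X" and
    bounds: "\<phi> {} = {}" "\<phi> (chromatic_atoms n) = U \<times> U" "\<phi> {Ident} = Id_on U" and
    convs: "\<forall>X\<in>Pow (chromatic_atoms n). \<phi> X = (\<phi> X)\<inverse>" and
    comps: "\<forall>X\<in>Pow (chromatic_atoms n). \<forall>Y\<in>Pow (chromatic_atoms n). \<forall>Z\<in>Pow (chromatic_atoms n).
      \<phi> X O \<phi> Y \<subseteq> \<phi> Z \<longleftrightarrow> {z. \<exists>x\<in>X. \<exists>y\<in>Y. consistent n x y z} \<subseteq> Z"
    unfolding qualitative_representation_def chromatic_algebra_2_def relation_type_algebra.simps
    by - (elim conjE, assumption)+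
  let ?K = "chromatic_atoms n"
  have join: "\<phi> (X \<union> Y) = \<phi> X \<union> \<phi> Y" if "X \<subseteq> ?K" "Y \<subseteq> ?K" for X Y
    using joins that by blast
  have meet: "\<phi> (X \<inter> Y) = \<phi> X \<inter> \<phi> Y" if "X \<subseteq> ?K" "Y \<subseteq> ?K" for X Y
    using meets that by blast
  have compl: "\<phi> (?K - X) = U \<times> U - \<phi> X" if "X \<subseteq> ?K" for X using compls that by blast
  have conv: "\<phi> X = (\<phi> X)\<inverse>" if "X \<subseteq> ?K" for X using convs that by blast
  have comp: "\<phi> X O \<phi> Y \<subseteq> \<phi> Z \<longleftrightarrow> {z. \<exists>x\<in>X. \<exists>y\<in>Y. consistent n x y z} \<subseteq> Z"
    if "X \<subseteq> ?K" "Y \<subseteq> ?K" "Z \<subseteq> ?K" for X Y Z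
    by (rule comps[rule_format]) (use that in simp_all)
  have sub: "\<phi> X \<subseteq> U \<times> U" if "X \<subseteq> ?K" for X using image that by blast
  have fin: "finite ?K" by (simp add: chromatic_atoms_def colours_def)
  \<comment> \<open>By finiteness, preservation of joins makes each \<open>\<phi> X\<close> the
    union of the images of its atoms. As these are disjoint, every pair in
    \<open>U \<times> U\<close> gets exactly one atom as its colour.\<close>
  have "\<exists>a\<in>X. e \<in> \<phi> {a}" if "finite X" "X \<subseteq> ?K" "e \<in> \<phi> X" for X e
    using that
  proof (induction X rule: finite_induct)
    case (insert a X)
    then show ?case using join[of "{a}" X] by auto
  qed (simp add: bounds)
  then have ex: "\<exists>a\<in>X. e \<in> \<phi> {a}" if "X \<subseteq> ?K" "e \<in> \<phi> X" for X e
    using that fin finite_subset by metis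
  have unique: "a = b" if "a \<in> ?K" "b \<in> ?K" "e \<in> \<phi> {a}" "e \<in> \<phi> {b}" for a b e
    using meet[of "{a}" "{b}"] that bounds by (cases "a = b") auto
  define col where "col x y = (THE a. a \<in> ?K \<and> (x, y) \<in> \<phi> {a})" for x y
  have colI: "col x y = a" if "a \<in> ?K" "(x, y) \<in> \<phi> {a}" for x y a
    unfolding col_def using that unique by (intro the_equality) auto
  have colD: "col x y \<in> ?K" "(x, y) \<in> \<phi> {col x y}" if xy: "x \<in> U" "y \<in> U" for x y
  proof -
    obtain a where a: "a \<in> ?K" "(x, y) \<in> \<phi> {a}" using ex[of ?K "(x, y)"] bounds xy by auto
    then show "col x y \<in> ?K" "(x, y) \<in> \<phi> {col x y}" using colI[OF a] by auto
  qed
  have colC: "col x y \<in> colours n" if "x \<in> U" "y \<in> U" "x \<noteq> y" for x y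
    using colD[OF that(1,2)] that(3) bounds(3) by (auto simp: chromatic_atoms_def)
  have consistent: "consistent n (col x y) (col y z) (col x z)"
    if "x \<in> U" "y \<in> U" "z \<in> U" for x y z
  proof -
    \<comment> \<open>\<open>?Z\<close> is the composition of the two atoms, the least element to
      which \<open>comp\<close> applies.\<close>
    let ?Z = "{c. consistent n (col x y) (col y z) c}"
    have Z: "?Z \<subseteq> ?K" by (auto simp: consistent_def)
    have "\<phi> {col x y} O \<phi> {col y z} \<subseteq> \<phi> ?Z" using comp[of "{col x y}" "{col y z}" ?Z] Z colD that by auto
    then have "(x, z) \<in> \<phi> ?Z" using colD that by blast
    then obtain c where "c \<in> ?Z" "(x, z) \<in> \<phi> {c}" using ex[OF Z] by blast
    then show ?thesis using colI[of c x z] Z by auto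
  qed
  have witness: "\<exists>x\<in>U. \<exists>y\<in>U. \<exists>z\<in>U. col x y = a \<and> col y z = b \<and> col x z = c"
    if "consistent n a b c" for a b c
  proof -
    have K: "a \<in> ?K" "b \<in> ?K" "c \<in> ?K" using that by (auto simp: consistent_def)
    \<comment> \<open>The other direction of \<open>comp\<close>: since \<open>c\<close> belongs to
      the composition, the inclusion into the complement of \<open>c\<close> fails, and a pair
      violating it yields the triangle.\<close>
    have "\<not> \<phi> {a} O \<phi> {b} \<subseteq> \<phi> (?K - {c})" using comp[of "{a}" "{b}" "?K - {c}"] K that by auto
    then obtain x y z where xyz: "(x, y) \<in> \<phi> {a}" "(y, z) \<in> \<phi> {b}" "(x, z) \<notin> \<phi> (?K - {c})" by blast
    have U: "x \<in> U" "y \<in> U" "z \<in> U" using sub K xyz(1,2) by blast+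
    have "(x, z) \<in> \<phi> {c}" using compl[of "{c}"] K U xyz(3) by auto
    then show ?thesis using colI K xyz U by blast
  qed
  have ident: "col x x = Ident" if "x \<in> U" for x
    using that bounds by (intro colI) (auto simp: chromatic_atoms_def)
  have card: "card (colours n) > 2"
    using assms by (simp add: colours_def card_image inj_on_def)
  show False
  proof (rule two_coloured_triangles_contradiction[OF card, of U col])
    fix x y assume xy: "x \<in> U" "y \<in> U"
    have "(y, x) \<in> \<phi> {col x y}" using conv[of "{col x y}"] colD[OF xy] by (metis converse_iff empty_subsetI insert_subset)
    then show "col x y = col y x" using colI colD(1)[OF xy] by metis
  next
    fix x y z assume xyz: "x \<in> U" "y \<in> U" "z \<in> U" "x \<noteq> y" "y \<noteq> z" "x \<noteq> z"
    have "col x y \<noteq> Ident" "col y z \<noteq> Ident" "col x z \<noteq> Ident"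
      using colC xyz by (metis chromatic_atom.distinct(1) colours_def imageE)+
    then show "card {col x y, col y z, col x z} = 2"
      using consistent[OF xyz(1-3)] by (simp add: consistent_def)
  next
    fix c d assume cd: "c \<in> colours n" "d \<in> colours n" "c \<noteq> d"
    have "consistent n c c d" using cd by (simp add: consistent_def chromatic_atoms_def)
    then obtain x y z where xyz: "x \<in> U" "y \<in> U" "z \<in> U" "col x y = c" "col y z = c" "col x z = d"
      using witness by blast
    \<comment> \<open>Loops are coloured \<open>Ident\<close>, so the three points are
      distinct.\<close>
    have "c \<noteq> Ident" "d \<noteq> Ident" using cd by (auto simp: colours_def)
    then show "\<exists>x\<in>U. \<exists>y\<in>U. \<exists>z\<in>U. x \<noteq> y \<and> y \<noteq> z \<and> x \<noteq> z \<and>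
        col x y = c \<and> col y z = c \<and> col x z = d"
      using xyz ident by metis
  qed (use colC in blast)
qed

end
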